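(* Let $X$ be a real vector space equipped with a complete and invariant metric ${\bf d}$ such that ${\bf d}(\lambda x,\lambda y)\le \lambda\,{\bf d}(x,y)$ for all $\lambda\in[0,1)$ and all $x,y\in X$. Let $f:[a,b]\to X$ be Riemann integrable on $[a,b]$, and define $F(t):=\int_a^t f(s)\,ds$ for $t\in[a,b]$. Then for every $t\in[a,b]$ at which $f$ is continuous, $F$ is differentiable at $t$ and $F'(t)=f(t)$.
   Context: The metric ${\bf d}$ on $X$ is invariant if ${\bf d}(x+z,y+z)={\bf d}(x,y)$ for all $x,y,z\in X$, and complete if every Cauchy sequence converges in $X$. A tagged partition of $[a,b]$ is $\Delta=\{(s_i,[t_{i-1},t_i]):1\le i\le N\}$ with $a=t_0<t_1<\dots<t_N=b$ and tags $s_i\in[t_{i-1},t_i]$; write $|\Delta|:=\max_{1\le i\le N}(t_i-t_{i-1})$ and $f(\Delta):=\sum_{i=1}^N(t_i-t_{i-1})f(s_i)$. A function $f:[a,b]\to X$ is Riemann integrable on $[a,b]$ if there is $\bar x\in X$ such that for every $\varepsilon>0$ there is $\delta>0$ with ${\bf d}(f(\Delta),\bar x)<\varepsilon$ for every tagged partition $\Delta$ of $[a,b]$ with $|\Delta|<\delta$; then $\bar x$ is denoted $\int_a^b f(t)\,dt$. The integral $\int_a^t f(s)\,ds$ is that of the restriction of $f$ to $[a,t]$ (and is $0$ for $t=a$). A function $\varphi:[a,b]\to X$ is differentiable at $t\in[a,b]$ with derivative $\varphi'(t)=x_t\in X$ if ${\bf d}(0,\varphi(t+s)-\varphi(t)-s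 x_t)=o(s)$ as $s\to0$ with $t+s\in[a,b]$. *)

theory Defs
  imports "HOL-Analysis.Analysis" "HOL-Library.Landau_Symbols"
begin

text \<open>
  The space \<open>X\<close> is a type of sort \<open>{real_vector, metric_space}\<close> (resp. \<open>complete_space\<close>).  This sort
  imposes no compatibility between \<^const>\<open>dist\<close> and the vector space operations, so invariance and the
  scaling inequality are separate hypotheses where they are needed.
\<close>

text \<open>
  The tagged partition \<open>{(s i, [t (i - 1), t i]) | 1 \<le> i \<le> N}\<close> is given by \<open>N\<close>, \<open>t\<close>, \<open>s\<close>; only the
  values \<open>t 0, \<dots>, t N\<close> and \<open>s 1, \<dots>, s N\<close> matter.
\<close>

definition tagged_partition :: "real \<Rightarrow> real \<Rightarrow> nat \<Rightarrow> (nat \<Rightarrow> real) \<Rightarrow> (nat \<Rightarrow> real) \<Rightarrow> bool" where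
  "tagged_partition a b N t s \<longleftrightarrow>
     1 \<le> N \<and> t 0 = a \<and> t N = b \<and>
     (\<forall>i\<in>{1..N}. t (i - 1) < t i \<and> s i \<in> {t (i - 1)..t i})"

definition mesh :: "nat \<Rightarrow> (nat \<Rightarrow> real) \<Rightarrow> real" where
  "mesh N t = Max ((\<lambda>i. t i - t (i - 1)) ` {1..N})"

definition riemann_sum ::
  "(real \<Rightarrow> 'a::real_vector) \<Rightarrow> nat \<Rightarrow> (nat \<Rightarrow> real) \<Rightarrow> (nat \<Rightarrow> real) \<Rightarrow> 'a" where
  "riemann_sum f N t s = (\<Sum>i=1..N. (t i - t (i - 1)) *\<^sub>R f (s i))"

definition has_riemann_integral ::
  "(real \<Rightarrow> 'a::{real_vector, metric_space}) \<Rightarrow> real \<Rightarrow> real \<Rightarrow> 'a \<Rightarrow> bool" where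
  "has_riemann_integral f a b x \<longleftrightarrow>
     (\<forall>\<epsilon>>0. \<exists>\<delta>>0. \<forall>N t s. tagged_partition a b N t s \<and> mesh N t < \<delta> \<longrightarrow>
        dist (riemann_sum f N t s) x < \<epsilon>)"

definition riemann_integrable ::
  "(real \<Rightarrow> 'a::{real_vector, metric_space}) \<Rightarrow> real \<Rightarrow> real \<Rightarrow> bool" where
  "riemann_integrable f a b \<longleftrightarrow> (\<exists>x. has_riemann_integral f a b x)"

text \<open>
  For \<open>a < b\<close> the value \<open>x\<close> in \<^const>\<open>has_riemann_integral\<close> is unique, since there are tagged partitions
  of arbitrarily small mesh.  Tags lie in \<open>[a, b]\<close>, so only the restriction of \<open>f\<close> to \<open>[a, b]\<close> matters.
\<close>

definition riemann_integral ::
  "(real \<Rightarrow> 'a::{real_vector, metric_space}) \<Rightarrow> real \<Rightarrow> real \<Rightarrow> 'a" where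
  "riemann_integral f a b = (if a = b then 0 else THE x. has_riemann_integral f a b x)"

text \<open>
  \<open>\<phi>\<close>, as a function on \<open>[a, b]\<close>, is differentiable at \<open>t\<close> with derivative \<open>x\<close>.  The library notions of
  derivative require a normed space.
\<close>

definition has_metric_derivative ::
  "(real \<Rightarrow> 'a::{real_vector, metric_space}) \<Rightarrow> 'a \<Rightarrow> real \<Rightarrow> real \<Rightarrow> real \<Rightarrow> bool" where
  "has_metric_derivative \<phi> x a b t \<longleftrightarrow>
     (\<lambda>s. dist 0 (\<phi> (t + s) - \<phi> t - s *\<^sub>R x)) \<in> o[at 0 within {s. t + s \<in> {a..b}}](\<lambda>s. s)"

end

theory Submission
  imports Defs
begin

text \<open>
  If \<open>a \<le> u < v \<le> b\<close>, concatenating fine partitions of \<open>[a, u]\<close> and \<open>[u, v]\<close> shows that \<open>F v - F u\<close> is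
  approximated by Riemann sums of \<open>f\<close> over \<open>[u, v]\<close>.  When \<open>f\<close> stays within \<open>\<eta>\<close> of \<open>f t\<close> on \<open>[u, v]\<close>,
  invariance and scaling put each such sum within \<open>(v - u) \<eta>\<close> of \<open>(v - u) f t\<close>.  Integrability on
  \<open>[a, v]\<close> follows from completeness: two fine partitions of \<open>[a, v]\<close> extended by the same partition
  of \<open>[v, b]\<close> have sums whose distance is unchanged by the extension.
\<close>

section \<open>Riemann sums over partitions of small mesh\<close>

definition riemann_sums :: "(real \<Rightarrow> 'a::real_vector) \<Rightarrow> real \<Rightarrow> real \<Rightarrow> real \<Rightarrow> 'a set" where
  "riemann_sums f a b \<delta> = {riemann_sum f N t s | N t s. tagged_partition a b N t s \<and> mesh N t < \<delta>}"

text \<open>Recasts the integral as a limit along the sets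
  \<open>riemann_sums f a b \<delta>\<close>, which shrink with \<open>\<delta>\<close>. The limit
  arguments below use only these sets and never handle a partition explicitly.\<close>

lemma has_riemann_integral_iff:
  "has_riemann_integral f a b x \<longleftrightarrow> (\<forall>\<epsilon>>0. \<exists>\<delta>>0. \<forall>S\<in>riemann_sums f a b \<delta>. dist S x < \<epsilon>)"
proof -
  have "(\<forall>S\<in>riemann_sums f a b \<delta>. dist S x < \<epsilon>) \<longleftrightarrow>
      (\<forall>N t s. tagged_partition a b N t s \<and> mesh N t < \<delta> \<longrightarrow> dist (riemann_sum f N t s) x < \<epsilon>)" for \<delta> \<epsilon>
    by (auto simp: riemann_sums_def)
  then show ?thesis
    by (simp only: has_riemann_integral_def)
qed

lemma riemann_sums_mono: "\<delta> \<le> \<delta>' \<Longrightarrow> riemann_sums f a b \<delta> \<subseteq> riemann_sums f a b \<delta>'"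
  unfolding riemann_sums_def by force

lemma mesh_less_iff:
  assumes "1 \<le> N"
  shows "mesh N t < \<delta> \<longleftrightarrow> (\<forall>i\<in>{1..N}. t i - t (i - 1) < \<delta>)"
  unfolding mesh_def using assms by (subst Max_less_iff) auto

text \<open>Supplies the fine partitions behind uniqueness of the integral, the approximating
  sequence in the Cauchy criterion, and the auxiliary sums over adjacent intervals.\<close>

lemma riemann_sums_nonempty:
  assumes "a < b" "0 < \<delta>"
  shows "riemann_sums f a b \<delta> \<noteq> {}"
proof -
  obtain n where n: "(b - a) / \<delta> < real n"
    using reals_Archimedean2 by blast
  have "0 < (b - a) / \<delta>"
    using assms by simp
  with n have n0: "0 < n"
    by (metis of_nat_0_less_iff less_trans)
  \<comment> \<open>Equal pieces, with right endpoints as tags. The choice of \<open>n\<close> gives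
    \<open>c < \<delta>\<close>.\<close>
  define c where "c = (b - a) / n"
  define t where "t i = a + real i * c" for i
  have step: "t i - t (i - 1) = c" if "i \<in> {1..n}" for i
    using that by (cases i) (auto simp: t_def algebra_simps)
  have pos: "0 < c" and small: "c < \<delta>"
    using assms n n0 by (auto simp: c_def field_simps)
  have "t (i - 1) < t i" if "i \<in> {1..n}" for i
    using step[OF that] pos by linarith
  moreover have "t 0 = a" "t n = b"
    using n0 by (auto simp: t_def c_def)
  ultimately have "tagged_partition a b n t t"
    unfolding tagged_partition_def using n0 by (auto intro: less_imp_le)
  moreover have "mesh n t < \<delta>"
    using n0 small step by (subst mesh_less_iff) auto
  ultimately show ?thesis
    unfolding riemann_sums_def by blast
qed

text \<open>The mesh of a concatenation is the larger of the two meshes, so the same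
  \<open>\<delta>\<close> survives.\<close>

lemma riemann_sums_concat:
  assumes S: "S \<in> riemann_sums f a b \<delta>" and T: "T \<in> riemann_sums f b c \<delta>"
  shows "S + T \<in> riemann_sums f a c \<delta>"
proof -
  obtain N t s where P: "tagged_partition a b N t s" "mesh N t < \<delta>" "S = riemann_sum f N t s"
    using S unfolding riemann_sums_def by blast
  obtain M u r where Q: "tagged_partition b c M u r" "mesh M u < \<delta>" "T = riemann_sum f M u r"
    using T unfolding riemann_sums_def by blast
  have N: "1 \<le> N" and M: "1 \<le> M" and tu: "t N = u 0"
    using P Q by (auto simp: tagged_partition_def)
  define w where "w i = (if i \<le> N then t i else u (i - N))" for i
  define q where "q i = (if i \<le> N then s i else r (i - N))" for i
  have left: "w i = t i" "w (i - 1) = t (i - 1)" "q i = s i" if "i \<in> {1..N}" for i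
    using that by (auto simp: w_def q_def)
  have right: "w (i + N) = u i" "w (i + N - 1) = u (i - 1)" "q (i + N) = r i" if "i \<in> {1..M}" for i
  proof -
    show "w (i + N) = u i" "q (i + N) = r i"
      using that by (auto simp: w_def q_def)
    \<comment> \<open>For \<open>i = 1\<close> the index is \<open>N\<close>, where \<open>w\<close>
      takes its value from \<open>t\<close>; the joint matches because
      \<open>t N = u 0\<close>.\<close>
    show "w (i + N - 1) = u (i - 1)"
      using that tu by (cases "i = 1") (auto simp: w_def)
  qed
  \<comment> \<open>Stated for an arbitrary predicate, so that it splits both the partition
    conditions and the mesh bound.\<close>
  have all: "(\<forall>i\<in>{1..N + M}. R i) \<longleftrightarrow> (\<forall>i\<in>{1..N}. R i) \<and> (\<forall>i\<in>{1..M}. R (i + N))" for R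
  proof (intro iffI conjI ballI)
    fix i
    assume R: "(\<forall>i\<in>{1..N}. R i) \<and> (\<forall>i\<in>{1..M}. R (i + N))" and i: "i \<in> {1..N + M}"
    show "R i"
    proof (cases "i \<le> N")
      case False
      then have "i - N \<in> {1..M}" "i - N + N = i"
        using i by auto
      then show ?thesis
        using R by metis
    qed (use R i in auto)
  qed auto
  have "tagged_partition a c (N + M) w q"
    unfolding tagged_partition_def all
    using P(1) Q(1) N M left right by (auto simp: tagged_partition_def w_def[of 0] w_def[of "N + M"])
  moreover have "mesh (N + M) w < \<delta>"
    using P(2) Q(2) N M left right by (simp add: mesh_less_iff all del: One_nat_def)
  moreover have "riemann_sum f (N + M) w q = S + T"
  proof -
    have "riemann_sum f (N + M) w q =
        (\<Sum>i=1..N. (w i - w (i - 1)) *\<^sub>R f (q i)) + (\<Sum>i=N+1..N+M. (w i - w (i - 1)) *\<^sub>R f (q i))"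
      unfolding riemann_sum_def by (rule sum.ub_add_nat) simp
    also have "(\<Sum>i=N+1..N+M. (w i - w (i - 1)) *\<^sub>R f (q i)) =
        (\<Sum>i=1..M. (w (i + N) - w (i + N - 1)) *\<^sub>R f (q (i + N)))"
      using sum.shift_bounds_cl_nat_ivl[of "\<lambda>i. (w i - w (i - 1)) *\<^sub>R f (q i)" 1 N M]
      by (simp add: add.commute)
    finally show ?thesis
      using left right by (simp add: P(3) Q(3) riemann_sum_def del: One_nat_def)
  qed
  ultimately show ?thesis
    unfolding riemann_sums_def by (intro CollectI exI[of _ "N + M"] exI[of _ w] exI[of _ q]) simp
qed

section \<open>Uniqueness, the Cauchy criterion, and integrability on initial subintervals\<close>

lemma has_riemann_integral_unique:
  assumes "a < b" "has_riemann_integral f a b x" "has_riemann_integral f a b y"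
  shows "x = y"
proof (rule ccontr)
  assume "x \<noteq> y"
  then have e: "0 < dist x y / 2"
    by simp
  obtain d1 where d1: "0 < d1" "\<And>S. S \<in> riemann_sums f a b d1 \<Longrightarrow> dist S x < dist x y / 2"
    using assms(2) e unfolding has_riemann_integral_iff by blast
  obtain d2 where d2: "0 < d2" "\<And>S. S \<in> riemann_sums f a b d2 \<Longrightarrow> dist S y < dist x y / 2"
    using assms(3) e unfolding has_riemann_integral_iff by blast
  obtain S where "S \<in> riemann_sums f a b (min d1 d2)"
    using riemann_sums_nonempty[OF \<open>a < b\<close>, of "min d1 d2"] d1 d2 by fastforce
  then have "S \<in> riemann_sums f a b d1" "S \<in> riemann_sums f a b d2"
    using riemann_sums_mono by (meson min.cobounded1 min.cobounded2 subsetD)+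
  then have "dist S x < dist x y / 2" "dist S y < dist x y / 2"
    using d1 d2 by auto
  then show False
    using dist_triangle2[of x y S] by (simp add: dist_commute)
qed

lemma has_riemann_integral_riemann_integral:
  assumes "a < b" "riemann_integrable f a b"
  shows "has_riemann_integral f a b (riemann_integral f a b)"
proof -
  have "\<exists>!x. has_riemann_integral f a b x"
    using assms has_riemann_integral_unique unfolding riemann_integrable_def by blast
  then show ?thesis
    using assms(1) theI'[of "has_riemann_integral f a b"] by (simp add: riemann_integral_def)
qed

text \<open>Pick one sum of mesh below \<open>1 / (n + 1)\<close> for each \<open>n\<close>. These
  form a Cauchy sequence, and completeness provides its limit, which is the integral.\<close>

lemma riemann_integrable_Cauchy:
  fixes f :: "real \<Rightarrow> 'a::{real_vector, complete_space}"
  assumes "a < b"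
    and Cauchy: "\<And>\<epsilon>. 0 < \<epsilon> \<Longrightarrow>
      \<exists>\<delta>>0. \<forall>S\<in>riemann_sums f a b \<delta>. \<forall>T\<in>riemann_sums f a b \<delta>. dist S T < \<epsilon>"
  shows "riemann_integrable f a b"
proof -
  have "\<exists>S. S \<in> riemann_sums f a b (inverse (Suc n))" for n
    using riemann_sums_nonempty[OF \<open>a < b\<close>, of "inverse (Suc n)" f] by fastforce
  then obtain S where S: "\<And>n. S n \<in> riemann_sums f a b (inverse (Suc n))"
    by metis
  have fine: "\<exists>m. \<forall>n\<ge>m. S n \<in> riemann_sums f a b \<delta>" if \<delta>: "0 < \<delta>" for \<delta>
  proof -
    obtain m where m: "inverse (Suc m) < \<delta>"
      using reals_Archimedean[OF \<delta>] by auto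
    have "S n \<in> riemann_sums f a b \<delta>" if "m \<le> n" for n
    proof -
      have "inverse (real (Suc n)) \<le> inverse (Suc m)"
        using that by (intro le_imp_inverse_le) auto
      with m have "inverse (real (Suc n)) \<le> \<delta>"
        by linarith
      then show ?thesis
        using S[of n] riemann_sums_mono by blast
    qed
    then show ?thesis
      by blast
  qed
  have "Cauchy S"
    unfolding Cauchy_def
  proof (intro allI impI)
    fix \<epsilon> :: real
    assume "0 < \<epsilon>"
    then show "\<exists>m. \<forall>i\<ge>m. \<forall>j\<ge>m. dist (S i) (S j) < \<epsilon>"
      using Cauchy[of \<epsilon>] fine by meson
  qed
  then obtain y where y: "S \<longlonglongrightarrow> y"
    using Cauchy_convergent_iff convergent_def by blast
  have "has_riemann_integral f a b y"
    unfolding has_riemann_integral_iff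
  proof (intro allI impI)
    fix \<epsilon> :: real
    assume "0 < \<epsilon>"
    then have e: "0 < \<epsilon> / 2"
      by simp
    obtain \<delta> where \<delta>: "0 < \<delta>"
        "\<And>S T. S \<in> riemann_sums f a b \<delta> \<Longrightarrow> T \<in> riemann_sums f a b \<delta> \<Longrightarrow> dist S T < \<epsilon> / 2"
      using Cauchy[OF e] by blast
    obtain m1 where m1: "\<And>n. m1 \<le> n \<Longrightarrow> S n \<in> riemann_sums f a b \<delta>"
      using fine[OF \<delta>(1)] by blast
    obtain m2 where m2: "\<And>n. m2 \<le> n \<Longrightarrow> dist (S n) y < \<epsilon> / 2"
      using y e unfolding lim_sequentially by blast
    \<comment> \<open>Any fine sum is compared with one term of the sequence, taken late enough to
      be both \<open>\<delta>\<close>-fine and close to \<open>y\<close>.\<close>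
    have "dist T y < \<epsilon>" if "T \<in> riemann_sums f a b \<delta>" for T
      using \<delta>(2)[OF that m1[of "max m1 m2"]] m2[of "max m1 m2"]
        dist_triangle[of T y "S (max m1 m2)"] by simp
    then show "\<exists>\<delta>>0. \<forall>T\<in>riemann_sums f a b \<delta>. dist T y < \<epsilon>"
      using \<delta>(1) by blast
  qed
  then show ?thesis
    unfolding riemann_integrable_def by blast
qed

lemma riemann_integrable_initial:
  fixes f :: "real \<Rightarrow> 'a::{real_vector, complete_space}"
  assumes invariant: "\<And>x y z :: 'a. dist (x + z) (y + z) = dist x y"
    and "riemann_integrable f a b" "a < v" "v \<le> b"
  shows "riemann_integrable f a v"
\<comment> \<open>A degenerate interval has no tagged partition, so the extension to
  \<open>[v, b]\<close> exists only for \<open>v < b\<close>.\<close>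
proof (cases "v = b")
  case False
  then have "v < b"
    using assms by simp
  obtain x where x: "has_riemann_integral f a b x"
    using assms unfolding riemann_integrable_def by blast
  show ?thesis
  proof (rule riemann_integrable_Cauchy[OF \<open>a < v\<close>])
    fix \<epsilon> :: real
    assume "0 < \<epsilon>"
    then have "0 < \<epsilon> / 2"
      by simp
    then obtain \<delta> where \<delta>: "0 < \<delta>" "\<And>S. S \<in> riemann_sums f a b \<delta> \<Longrightarrow> dist S x < \<epsilon> / 2"
      using x unfolding has_riemann_integral_iff by blast
    obtain R where R: "R \<in> riemann_sums f v b \<delta>"
      using riemann_sums_nonempty[OF \<open>v < b\<close> \<delta>(1)] by blast
    have "dist S T < \<epsilon>" if "S \<in> riemann_sums f a v \<delta>" "T \<in> riemann_sums f a v \<delta>" for S T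
    proof -
      have "dist (S + R) x < \<epsilon> / 2" "dist (T + R) x < \<epsilon> / 2"
        using that R riemann_sums_concat \<delta>(2) by blast+
      then show ?thesis
        using dist_triangle2[of "S + R" "T + R" x] by (simp add: invariant)
    qed
    then show "\<exists>\<delta>>0. \<forall>S\<in>riemann_sums f a v \<delta>. \<forall>T\<in>riemann_sums f a v \<delta>. dist S T < \<epsilon>"
      using \<delta>(1) by blast
  qed
qed (use assms in simp)

section \<open>Estimates from invariance and scaling\<close>

lemma dist_add_add_le:
  fixes x :: "'a::{real_vector, metric_space}"
  assumes invariant: "\<And>x y z :: 'a. dist (x + z) (y + z) = dist x y"
  shows "dist (x + y) (x' + y') \<le> dist x x' + dist y y'"
proof -
  \<comment> \<open>The summands are changed one at a time, passing through \<open>x' + y\<close>;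
    invariance cancels the common summand.\<close>
  have "dist (x + y) (x' + y) = dist x x'"
    by (rule invariant)
  moreover have "dist (x' + y) (x' + y') = dist y y'"
    using invariant[where x = y and y = y' and z = x'] by (simp only: add.commute[of x'])
  ultimately show ?thesis
    using dist_triangle[of "x + y" "x' + y'" "x' + y"] by linarith
qed

lemma dist_sum_sum_le:
  fixes g h :: "'b \<Rightarrow> 'a::{real_vector, metric_space}"
  assumes invariant: "\<And>x y z :: 'a. dist (x + z) (y + z) = dist x y"
  shows "dist (sum g A) (sum h A) \<le> (\<Sum>i\<in>A. dist (g i) (h i))"
proof (induction A rule: infinite_finite_induct)
  case (insert i A)
  then show ?case
    using dist_add_add_le[OF invariant, of "g i" "sum g A" "h i" "sum h A"] by simp
qed auto

lemma dist_diff_swap: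
  fixes x :: "'a::{real_vector, metric_space}"
  assumes invariant: "\<And>x y z :: 'a. dist (x + z) (y + z) = dist x y"
  shows "dist (x - y) z = dist x (z + y)"
  using invariant[where x = "x - y" and y = z and z = y] by (simp only: diff_add_cancel)

text \<open>
  The mesh bound \<open>1\<close> makes the scaling inequality applicable to every subinterval.
\<close>

lemma dist_riemann_sums_const_le:
  fixes f :: "real \<Rightarrow> 'a::{real_vector, metric_space}"
  assumes invariant: "\<And>x y z :: 'a. dist (x + z) (y + z) = dist x y"
    and scaling: "\<And>(c::real) (x::'a) y. 0 \<le> c \<Longrightarrow> c < 1 \<Longrightarrow> dist (c *\<^sub>R x) (c *\<^sub>R y) \<le> c * dist x y"
    and S: "S \<in> riemann_sums f u v 1"
    and close: "\<And>r. r \<in> {u..v} \<Longrightarrow> dist (f r) x \<le> \<eta>"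
  shows "dist S ((v - u) *\<^sub>R x) \<le> (v - u) * \<eta>"
proof -
  obtain N t s where P: "tagged_partition u v N t s" "mesh N t < 1" "S = riemann_sum f N t s"
    using S unfolding riemann_sums_def by blast
  have N: "1 \<le> N" and ends: "t 0 = u" "t N = v"
    and part: "\<And>i. i \<in> {1..N} \<Longrightarrow> t (i - 1) < t i \<and> s i \<in> {t (i - 1)..t i}"
    using P(1) unfolding tagged_partition_def by blast+
  have step: "t i - t (i - 1) < 1" if "i \<in> {1..N}" for i
    using P(2) that mesh_less_iff[OF N] by blast
  \<comment> \<open>Monotonicity of the nodes is what places every tag in \<open>[u, v]\<close>,
    where \<open>close\<close> applies.\<close>
  have mono: "t i \<le> t j" if "i \<le> j" "j \<le> N" for i j
    using that
  proof (induction j rule: dec_induct)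
    case (step k)
    then show ?case
      using part[of "Suc k"] by auto
  qed simp
  have tag: "s i \<in> {u..v}" if "i \<in> {1..N}" for i
  proof -
    have "t 0 \<le> t (i - 1)" "t i \<le> t N"
      using that by (auto intro: mono)
    then show ?thesis
      using part[OF that] ends by auto
  qed
  \<comment> \<open>Used twice: to expand \<open>(v - u) *\<^sub>R x\<close> as the Riemann sum of a
    constant, and to add up the termwise bounds.\<close>
  have length: "(\<Sum>i=1..N. t i - t (i - 1)) = v - u"
    using sum_telescope''[of 0 N t] ends by simp
  have "dist S ((v - u) *\<^sub>R x) =
      dist (\<Sum>i=1..N. (t i - t (i - 1)) *\<^sub>R f (s i)) (\<Sum>i=1..N. (t i - t (i - 1)) *\<^sub>R x)"
    by (simp add: P(3) riemann_sum_def flip: length scaleR_sum_left)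
  also have "\<dots> \<le> (\<Sum>i=1..N. dist ((t i - t (i - 1)) *\<^sub>R f (s i)) ((t i - t (i - 1)) *\<^sub>R x))"
    by (rule dist_sum_sum_le[OF invariant])
  also have "\<dots> \<le> (\<Sum>i=1..N. (t i - t (i - 1)) * \<eta>)"
  proof (rule sum_mono)
    fix i
    assume i: "i \<in> {1..N}"
    have nn: "0 \<le> t i - t (i - 1)"
      using part[OF i] by simp
    then have "dist ((t i - t (i - 1)) *\<^sub>R f (s i)) ((t i - t (i - 1)) *\<^sub>R x)
        \<le> (t i - t (i - 1)) * dist (f (s i)) x"
      using scaling step[OF i] by blast
    also have "\<dots> \<le> (t i - t (i - 1)) * \<eta>"
      using close[OF tag[OF i]] nn by (rule mult_left_mono)
    finally show "dist ((t i - t (i - 1)) *\<^sub>R f (s i)) ((t i - t (i - 1)) *\<^sub>R x)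
        \<le> (t i - t (i - 1)) * \<eta>" .
  qed
  also have "\<dots> = (v - u) * \<eta>"
    by (simp only: length flip: sum_distrib_right)
  finally show ?thesis .
qed

text \<open>The increment is kept in additive form to match a concatenated sum \<open>R + S\<close>.
  The length \<open>v - u\<close> may exceed 1, since scaling is applied only to the pieces of a
  partition.\<close>

lemma dist_riemann_integral_diff_le:
  fixes f :: "real \<Rightarrow> 'a::{real_vector, complete_space}"
  assumes invariant: "\<And>x y z :: 'a. dist (x + z) (y + z) = dist x y"
    and scaling: "\<And>(c::real) (x::'a) y. 0 \<le> c \<Longrightarrow> c < 1 \<Longrightarrow> dist (c *\<^sub>R x) (c *\<^sub>R y) \<le> c * dist x y"
    and int: "riemann_integrable f a b" and "a \<le> u" "u < v" "v \<le> b"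
    and close: "\<And>r. r \<in> {u..v} \<Longrightarrow> dist (f r) x \<le> \<eta>"
  shows "dist (riemann_integral f a v) ((v - u) *\<^sub>R x + riemann_integral f a u) \<le> (v - u) * \<eta>"
proof (rule field_le_epsilon)
  let ?I = "riemann_integral f a"
  fix e :: real
  assume "0 < e"
  then have e: "0 < e / 2"
    by simp
  have "riemann_integrable f a v"
    using riemann_integrable_initial[OF invariant int] assms by simp
  then have "has_riemann_integral f a v (?I v)"
    using assms by (intro has_riemann_integral_riemann_integral) auto
  then obtain d1 where d1: "0 < d1" "\<And>S. S \<in> riemann_sums f a v d1 \<Longrightarrow> dist S (?I v) < e / 2"
    using e unfolding has_riemann_integral_iff by blast
  \<comment> \<open>\<open>R\<close> stands for the part over \<open>[a, u]\<close>. If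
    \<open>a = u\<close> there is no partition to choose from, but the integral is 0 by definition,
    so \<open>R = 0\<close> serves.\<close>
  obtain R d2 where R: "0 < d2" "dist R (?I u) < e / 2"
    "\<And>S. S \<in> riemann_sums f u v d2 \<Longrightarrow> R + S \<in> riemann_sums f a v d1"
  proof (cases "a = u")
    case True
    then show ?thesis
      using that[of d1 0] d1 e by (simp add: riemann_integral_def)
  next
    case False
    then have "a < u"
      using assms by simp
    have "riemann_integrable f a u"
      using riemann_integrable_initial[OF invariant int \<open>a < u\<close>] assms by simp
    then obtain d2 where d2: "0 < d2" "\<And>S. S \<in> riemann_sums f a u d2 \<Longrightarrow> dist S (?I u) < e / 2"
      using has_riemann_integral_riemann_integral[OF \<open>a < u\<close>] e
      unfolding has_riemann_integral_iff by blast
    obtain R where R: "R \<in> riemann_sums f a u (min d1 d2)"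
      using riemann_sums_nonempty[OF \<open>a < u\<close>, of "min d1 d2"] d1 d2 by fastforce
    then have "R \<in> riemann_sums f a u d1" "R \<in> riemann_sums f a u d2"
      using riemann_sums_mono by (meson min.cobounded1 min.cobounded2 subsetD)+
    then show ?thesis
      using that[of d1 R] d1 d2 riemann_sums_concat by blast
  qed
  \<comment> \<open>Mesh below 1 permits scaling; mesh below \<open>d2\<close> makes
    \<open>R + S\<close> a fine sum over \<open>[a, v]\<close>. The errors of \<open>R + S\<close>
    and \<open>R\<close> use up \<open>e / 2\<close> each.\<close>
  obtain S where S: "S \<in> riemann_sums f u v (min 1 d2)"
    using riemann_sums_nonempty[OF \<open>u < v\<close>, of "min 1 d2"] R by fastforce
  then have "S \<in> riemann_sums f u v 1" "S \<in> riemann_sums f u v d2"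
    using riemann_sums_mono by (meson min.cobounded1 min.cobounded2 subsetD)+
  then have "dist S ((v - u) *\<^sub>R x) \<le> (v - u) * \<eta>" "dist (R + S) (?I v) < e / 2"
    using dist_riemann_sums_const_le[where f = f, OF invariant scaling] close R(3) d1(2) by blast+
  moreover have "dist (S + R) ((v - u) *\<^sub>R x + ?I u) \<le> dist S ((v - u) *\<^sub>R x) + dist R (?I u)"
    by (rule dist_add_add_le[OF invariant])
  ultimately show "dist (?I v) ((v - u) *\<^sub>R x + ?I u) \<le> (v - u) * \<eta> + e"
    using R(2) dist_triangle3[of "?I v" "(v - u) *\<^sub>R x + ?I u" "R + S"] by (simp add: add.commute)
qed

section \<open>Differentiability at points of continuity\<close>

theorem theorem2p1:
  fixes f F :: "real \<Rightarrow> 'a::{real_vector, complete_space}" and a b :: real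
  assumes invariant: "\<And>x y z :: 'a. dist (x + z) (y + z) = dist x y"
    and scaling: "\<And>(c::real) (x::'a) y. 0 \<le> c \<Longrightarrow> c < 1 \<Longrightarrow> dist (c *\<^sub>R x) (c *\<^sub>R y) \<le> c * dist x y"
    and "a < b"
    and "riemann_integrable f a b"
    and "\<And>t. t \<in> {a..b} \<Longrightarrow> F t = riemann_integral f a t"
  shows "\<forall>t\<in>{a..b}. continuous (at t within {a..b}) f \<longrightarrow> has_metric_derivative F (f t) a b t"
proof (intro ballI impI)
  fix t
  assume t: "t \<in> {a..b}" and cont: "continuous (at t within {a..b}) f"
  have incr: "dist (F v) ((v - u) *\<^sub>R f t + F u) \<le> (v - u) * \<eta>"
    if "a \<le> u" "u < v" "v \<le> b" "\<And>r. r \<in> {u..v} \<Longrightarrow> dist (f r) (f t) \<le> \<eta>" for u v \<eta>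
    using dist_riemann_integral_diff_le[OF invariant scaling assms(4) that] that assms(5) by simp
  show "has_metric_derivative F (f t) a b t"
    unfolding has_metric_derivative_def
  proof (rule landau_o.smallI)
    fix \<eta> :: real
    assume "0 < \<eta>"
    then obtain \<delta> where \<delta>: "0 < \<delta>" "\<And>r. r \<in> {a..b} \<Longrightarrow> dist r t < \<delta> \<Longrightarrow> dist (f r) (f t) < \<eta>"
      using cont unfolding continuous_within_eps_delta by blast
    have "dist 0 (F (t + s) - F t - s *\<^sub>R f t) \<le> \<eta> * \<bar>s\<bar>"
      if s: "t + s \<in> {a..b}" "\<bar>s\<bar> < \<delta>" "s \<noteq> 0" for s
    proof -
      \<comment> \<open>The interval between \<open>t\<close> and \<open>t + s\<close>, in either
        order, lies in \<open>[a, b]\<close> and within \<open>\<delta>\<close> of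
        \<open>t\<close>.\<close>
      have close: "dist (f r) (f t) \<le> \<eta>" if "r \<in> {min t (t + s)..max t (t + s)}" for r
        using that s t by (intro less_imp_le \<delta>(2)) (auto simp: dist_real_def min_def max_def split: if_splits)
      have eq: "dist 0 (F (t + s) - F t - s *\<^sub>R f t) = dist (F (t + s)) (s *\<^sub>R f t + F t)"
        using dist_diff_swap[OF invariant, of "F (t + s)" "s *\<^sub>R f t + F t" 0]
        by (simp add: dist_commute algebra_simps)
      show ?thesis
      proof (cases "0 < s")
        case True
        then show ?thesis
          using incr[of t "t + s" \<eta>] close s t eq by (simp add: mult.commute)
      next
        case False
        \<comment> \<open>For \<open>s < 0\<close> the increment is taken forward over
          \<open>[t + s, t]\<close>. Adding \<open>- (s *\<^sub>R f t)\<close> to both arguments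
          exchanges the roles of the endpoints.\<close>
        have "dist (F (t + s)) (s *\<^sub>R f t + F t) = dist (F t) ((t - (t + s)) *\<^sub>R f t + F (t + s))"
          using invariant[of "F (t + s)" "- (s *\<^sub>R f t)" "s *\<^sub>R f t + F t"]
          by (simp add: dist_commute algebra_simps)
        then show ?thesis
          using incr[of "t + s" t \<eta>] close s t eq False by (simp add: mult.commute)
      qed
    qed
    then show "\<forall>\<^sub>F s in at 0 within {s. t + s \<in> {a..b}}.
        norm (dist 0 (F (t + s) - F t - s *\<^sub>R f t)) \<le> \<eta> * norm s"
      unfolding eventually_at using \<delta>(1) by (auto simp: dist_real_def)
  qed
qed

end
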